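(* Let $N_A$ be a seminorm on $\mathbb{B}_A(\mathcal{H})$ and let $T\in\mathbb{B}_A(\mathcal{H})$. Then $$\omega_{N_A}(T)\ \geq\ \frac{N_A(T)}{2}+\frac{\big|N_A(\Re_A(T))-N_A(\Im_A(T))\big|}{2}.$$
   Context: $\mathcal{H}$ is a complex Hilbert space with inner product $\langle\cdot,\cdot\rangle$, $\mathbb{B}(\mathcal{H})$ is the algebra of bounded linear operators on $\mathcal{H}$, and $A\in\mathbb{B}(\mathcal{H})$ is a non-zero positive operator ($\langle Ax,x\rangle\ge 0$ for all $x$). $\mathbb{B}_A(\mathcal{H})$ is the set of $T\in\mathbb{B}(\mathcal{H})$ with $\mathcal{R}(T^*A)\subseteq\mathcal{R}(A)$ ($\mathcal{R}$ denotes range); it is a subalgebra of $\mathbb{B}(\mathcal{H})$. For $T\in\mathbb{B}_A(\mathcal{H})$, $T^{\sharp_A}$ is the unique $X\in\mathbb{B}(\mathcal{H})$ with $AX=T^*A$ and $\mathcal{R}(X)\subseteq\overline{\mathcal{R}(A)}$; one has $T^{\sharp_A}\in\mathbb{B}_A(\mathcal{H})$. Put $\Re_A(T)=\frac{T+T^{\sharp_A}}{2}$ and $\Im_A(T)=\frac{T-T^{\sharp_A}}{2i}$. For a seminorm $N_A$ on $\mathbb{B}_A(\mathcal{H})$, the generalized $A$-numerical radius is $\omega_{N_A}(T)=\sup_{\theta\in\mathbb{R}}N_A\big(\Re_A(e^{i\theta}T)\big)$ for $T\in\mathbb{B}_A(\mathcal{H})$. *)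

theory Defs
  imports "HOL-Analysis.Analysis"
begin

class complex_vector = real_vector +
  fixes scaleC :: "complex \<Rightarrow> 'a \<Rightarrow> 'a"  (infixr "*\<^sub>C" 75)
  assumes scaleC_add_right: "a *\<^sub>C (x + y) = a *\<^sub>C x + a *\<^sub>C y"
    and scaleC_add_left: "(a + b) *\<^sub>C x = a *\<^sub>C x + b *\<^sub>C x"
    and scaleC_scaleC: "a *\<^sub>C b *\<^sub>C x = (a * b) *\<^sub>C x"
    and scaleC_one: "1 *\<^sub>C x = x"
    and scaleR_scaleC: "scaleR r x = complex_of_real r *\<^sub>C x"

text \<open>The inner product is linear in the first argument and conjugate linear in the second.\<close>

class complex_inner = complex_vector + real_normed_vector +
  fixes cinner :: "'a \<Rightarrow> 'a \<Rightarrow> complex"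
  assumes cinner_commute: "cinner x y = cnj (cinner y x)"
    and cinner_add_left: "cinner (x + y) z = cinner x z + cinner y z"
    and cinner_scaleC_left: "cinner (c *\<^sub>C x) y = c * cinner x y"
    and cinner_self_nonneg: "cinner x x \<in> \<real>\<^sub>\<ge>\<^sub>0"
    and cinner_self_eq_zero: "cinner x x = 0 \<longleftrightarrow> x = 0"
    and norm_eq_sqrt_cinner: "norm x = sqrt (Re (cinner x x))"

class chilbert_space = complex_inner + complete_space

instantiation complex :: chilbert_space
begin

definition scaleC_complex :: "complex \<Rightarrow> complex \<Rightarrow> complex"
  where "scaleC_complex a x = a * x"

definition cinner_complex :: "complex \<Rightarrow> complex \<Rightarrow> complex"
  where "cinner_complex x y = x * cnj y"

instance
  by standard
    (auto simp: scaleC_complex_def cinner_complex_def algebra_simps scaleR_conv_of_real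
      complex_nonneg_Reals_iff cmod_def power2_eq_square)

end

definition bounded_clinear :: "('a::complex_inner \<Rightarrow> 'a) \<Rightarrow> bool"
  where "bounded_clinear T \<longleftrightarrow> bounded_linear T \<and> (\<forall>c x. T (c *\<^sub>C x) = c *\<^sub>C T x)"

definition cadjoint :: "('a::chilbert_space \<Rightarrow> 'a) \<Rightarrow> 'a \<Rightarrow> 'a"
  where "cadjoint T = (THE S. \<forall>x y. cinner (T x) y = cinner x (S y))"

definition positive_op :: "('a::complex_inner \<Rightarrow> 'a) \<Rightarrow> bool"
  where "positive_op A \<longleftrightarrow> bounded_clinear A \<and> (\<forall>x. cinner (A x) x \<in> \<real>\<^sub>\<ge>\<^sub>0)"

text \<open>The algebra \<open>\<bool>\<^sub>A(H)\<close> of operators admitting an \<open>A\<close>-adjoint.\<close>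

definition ops_A :: "('a::chilbert_space \<Rightarrow> 'a) \<Rightarrow> ('a \<Rightarrow> 'a) set"
  where "ops_A A = {T. bounded_clinear T \<and> range (cadjoint T \<circ> A) \<subseteq> range A}"

definition sharp :: "('a::chilbert_space \<Rightarrow> 'a) \<Rightarrow> ('a \<Rightarrow> 'a) \<Rightarrow> 'a \<Rightarrow> 'a"
  where "sharp A T =
    (THE X. bounded_clinear X \<and> A \<circ> X = cadjoint T \<circ> A \<and> range X \<subseteq> closure (range A))"

definition Re_A :: "('a::chilbert_space \<Rightarrow> 'a) \<Rightarrow> ('a \<Rightarrow> 'a) \<Rightarrow> 'a \<Rightarrow> 'a"
  where "Re_A A T = (\<lambda>x. (1 / 2) *\<^sub>C (T x + sharp A T x))"

definition Im_A :: "('a::chilbert_space \<Rightarrow> 'a) \<Rightarrow> ('a \<Rightarrow> 'a) \<Rightarrow> 'a \<Rightarrow> 'a"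
  where "Im_A A T = (\<lambda>x. (1 / (2 * \<i>)) *\<^sub>C (T x - sharp A T x))"

text \<open>A seminorm on a complex vector space \<open>V\<close> of operators with pointwise operations;
  the values of \<open>N\<close> outside \<open>V\<close> are irrelevant.\<close>

definition seminorm_on :: "('a::complex_vector \<Rightarrow> 'a) set \<Rightarrow> (('a \<Rightarrow> 'a) \<Rightarrow> real) \<Rightarrow> bool"
  where "seminorm_on V N \<longleftrightarrow>
    (\<forall>S\<in>V. 0 \<le> N S) \<and>
    (\<forall>c. \<forall>S\<in>V. N (\<lambda>x. c *\<^sub>C S x) = cmod c * N S) \<and>
    (\<forall>S\<in>V. \<forall>T\<in>V. N (\<lambda>x. S x + T x) \<le> N S + N T)"

text \<open>The supremum is taken in the reals. For a seminorm \<open>N\<close> on \<open>ops_A A\<close> and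
  \<open>T \<in> ops_A A\<close> the family is bounded above by \<open>N (Re_A A T) + N (Im_A A T)\<close>, because
  \<open>Re_A A (e\<^sup>i\<^sup>\<theta> T) = cos \<theta> Re_A A T - sin \<theta> Im_A A T\<close>.\<close>

definition num_radius_A ::
  "('a::chilbert_space \<Rightarrow> 'a) \<Rightarrow> (('a \<Rightarrow> 'a) \<Rightarrow> real) \<Rightarrow> ('a \<Rightarrow> 'a) \<Rightarrow> real"
  where "num_radius_A A N T =
    (SUP \<theta>::real. N (Re_A A (\<lambda>x. exp (\<i> * complex_of_real \<theta>) *\<^sub>C T x)))"

end

theory Submission
  imports Defs
begin

text \<open>Write \<open>R\<close> and \<open>I\<close> for the \<open>A\<close>-real and \<open>A\<close>-imaginary parts of \<open>T\<close>. Since passing to the reduced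
  adjoint \<open>sharp A T\<close> is conjugate linear in \<open>T\<close>, the \<open>A\<close>-real part of \<open>c T\<close> is \<open>(Re c) R - (Im c) I\<close>
  (lemma \<open>Re_A_scaleC\<close>). The rotations \<open>c = 1\<close> and \<open>c = \<i>\<close> therefore show that the numerical radius
  is at least \<open>max (N R) (N I)\<close>, which equals \<open>(N R + N I) / 2 + \<bar>N R - N I\<bar> / 2\<close>, and
  \<open>N R + N I \<ge> N T\<close> because \<open>T = R + \<i> I\<close>.

  The seminorm says nothing about operators outside \<open>ops_A A\<close>, and \<open>sharp A T\<close> is a definite
  description, so most of the work goes into showing that \<open>sharp A T\<close> exists and again belongs to
  \<open>ops_A A\<close>. For each \<open>x\<close> the vector \<open>T\<^sup>* A x\<close> has a preimage under \<open>A\<close>; its orthogonal projection to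
  the closure of the range of \<open>A\<close>, which is the orthogonal complement of the kernel, is the only
  preimage in that closure, and this determines a linear map \<open>X\<close>. Boundedness of \<open>X\<close> comes from the
  uniform boundedness principle, by way of the identity \<open>\<langle>X x, A y\<rangle> = \<langle>x, A T y\<rangle>\<close>: the
  functionals \<open>x \<mapsto> \<langle>x, A T y\<rangle> / \<parallel>A y\<parallel>\<close> are bounded at each \<open>x\<close> by \<open>\<parallel>X x\<parallel>\<close>, hence bounded uniformly in
  \<open>y\<close>. That \<open>X\<close> lies in \<open>ops_A A\<close> follows by taking adjoints in \<open>A X = T\<^sup>* A\<close>, which gives
  \<open>X\<^sup>* A = A T\<close>. Adjoints and projections are both instances of the Riesz representation theorem on
  a closed subspace.\<close>

section \<open>Complex inner product spaces\<close>

interpretation complex_vector: vector_space "scaleC :: complex \<Rightarrow> 'a \<Rightarrow> 'a::complex_vector"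
  by unfold_locales (simp_all add: scaleC_add_right scaleC_add_left scaleC_scaleC scaleC_one)

lemma cinner_add_right: "cinner x (y + z) = cinner x y + cinner x z"
  by (metis cinner_add_left cinner_commute complex_cnj_add)

lemma cinner_scaleC_right: "cinner x (c *\<^sub>C y) = cnj c * cinner x y"
  by (metis cinner_scaleC_left cinner_commute complex_cnj_mult)

lemma cinner_zero_left [simp]: "cinner 0 x = 0"
  using cinner_add_left[of 0 0 x] by simp

lemma cinner_zero_right [simp]: "cinner x 0 = 0"
  using cinner_add_right[of x 0 0] by simp

lemma cinner_diff_right: "cinner x (y - z) = cinner x y - cinner x z"
  using cinner_add_right[of x "y - z" z] by simp

lemma cinner_minus_right: "cinner x (- y) = - cinner x y"
  using cinner_diff_right[of x 0 y] by simp

lemma cinner_self: "cinner x x = complex_of_real ((norm x)\<^sup>2)"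
  using cinner_self_nonneg[of x]
  by (auto simp: norm_eq_sqrt_cinner complex_nonneg_Reals_iff complex_eq_iff)

lemma norm_scaleC: "norm (c *\<^sub>C x) = cmod c * norm (x :: 'a::complex_inner)"
proof -
  have "complex_of_real ((norm (c *\<^sub>C x))\<^sup>2) = (c * cnj c) * cinner x x"
    by (simp only: cinner_self[symmetric] cinner_scaleC_left cinner_scaleC_right mult_ac)
  also have "\<dots> = complex_of_real ((cmod c * norm x)\<^sup>2)"
    by (simp only: cinner_self complex_norm_square[symmetric] power_mult_distrib of_real_mult)
  finally have "complex_of_real ((norm (c *\<^sub>C x))\<^sup>2) = complex_of_real ((cmod c * norm x)\<^sup>2)" .
  then have "(norm (c *\<^sub>C x))\<^sup>2 = (cmod c * norm x)\<^sup>2"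
    by (simp only: of_real_eq_iff)
  then show ?thesis
    by (simp add: power2_eq_iff_nonneg)
qed

lemma norm_add_square:
  "(norm (x + y))\<^sup>2 = (norm x)\<^sup>2 + 2 * Re (cinner x y) + (norm (y :: 'a::complex_inner))\<^sup>2"
proof -
  have "complex_of_real ((norm (x + y))\<^sup>2) = cinner x x + cinner x y + cnj (cinner x y) + cinner y y"
    unfolding cinner_self[symmetric] cinner_add_left cinner_add_right
    by (simp add: cinner_commute[of y x])
  from arg_cong[OF this, of Re] show ?thesis
    by (simp add: cinner_self del: of_real_power)
qed

lemma Re_cinner_le: "Re (cinner x y) \<le> norm x * norm (y :: 'a::complex_inner)"
proof -
  have "(norm (x + y))\<^sup>2 \<le> (norm x + norm y)\<^sup>2"
    by (intro power_mono norm_triangle_ineq) auto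
  then show ?thesis
    by (simp add: norm_add_square power2_sum)
qed

text \<open>Multiplying \<open>x\<close> by a unimodular scalar makes the inner product real and nonnegative, and
  for its real part the bound is a reformulation of the triangle inequality.\<close>

lemma cinner_Cauchy_Schwarz: "cmod (cinner x y) \<le> norm x * norm (y :: 'a::complex_inner)"
proof (cases "cinner x y = 0")
  case False
  define c where "c = cnj (sgn (cinner x y))"
  have "c * cinner x y = complex_of_real (cmod (cinner x y))"
    using False complex_norm_square[of "cinner x y"]
    by (simp add: c_def sgn_eq field_simps power2_eq_square)
  then have "cmod (cinner x y) = Re (cinner (c *\<^sub>C x) y)"
    by (simp add: cinner_scaleC_left)
  also have "\<dots> \<le> norm (c *\<^sub>C x) * norm y"
    by (rule Re_cinner_le)
  also have "\<dots> = norm x * norm y"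
    using False by (simp add: norm_scaleC c_def norm_sgn)
  finally show ?thesis .
qed auto

lemma cinner_ext: "(\<And>u. cinner u x = cinner u y) \<Longrightarrow> x = y"
  using cinner_self_eq_zero[of "x - y"] by (simp add: cinner_diff_right)

lemma bounded_linear_cinner_left: "bounded_linear (\<lambda>x :: 'a::complex_inner. cinner x y)"
  by (rule bounded_linear_intro[where K = "norm y"])
    (simp_all add: cinner_add_left scaleR_scaleC cinner_scaleC_left scaleC_complex_def
      cinner_Cauchy_Schwarz)

lemma bounded_linear_cinner_right: "bounded_linear (\<lambda>y :: 'a::complex_inner. cinner x y)"
  by (rule bounded_linear_intro[where K = "norm x"])
    (use cinner_Cauchy_Schwarz[of x] in \<open>simp_all add: cinner_add_right scaleR_scaleC
      cinner_scaleC_right scaleC_complex_def mult.commute[of _ "norm x"]\<close>)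

lemma bounded_linear_scaleC: "bounded_linear (\<lambda>x :: 'a::complex_inner. c *\<^sub>C x)"
  by (rule bounded_linear_intro[where K = "cmod c"])
    (simp_all add: scaleR_scaleC complex_vector.scale_right_distrib norm_scaleC mult.commute)

text \<open>By continuity the bound extends from \<open>S\<close> to its closure, where it can be tested
  on \<open>y = z\<close>. With \<open>K = 0\<close> this says that a vector in the closure of \<open>S\<close> that is orthogonal to \<open>S\<close>
  vanishes.\<close>

lemma norm_le_if_cinner_bound:
  assumes bound: "\<And>y. y \<in> S \<Longrightarrow> cmod (cinner z y) \<le> K * norm y"
    and z: "z \<in> closure S" and "0 \<le> K"
  shows "norm (z :: 'a::complex_inner) \<le> K"
proof -
  have "closed {y. cmod (cinner z y) \<le> K * norm y}"
    by (intro closed_Collect_le continuous_intros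
        linear_continuous_on[OF bounded_linear_cinner_right])
  then have "closure S \<subseteq> {y. cmod (cinner z y) \<le> K * norm y}"
    using bound by (intro closure_minimal) auto
  then have "cmod (cinner z z) \<le> K * norm z"
    using z by auto
  then have "norm z * norm z \<le> K * norm z"
    by (simp add: cinner_self norm_power power2_eq_square norm_mult)
  then show ?thesis
    using \<open>0 \<le> K\<close> by (cases "z = 0") auto
qed

section \<open>Riesz representation and orthogonal projection\<close>

definition csubspace :: "'a::complex_vector set \<Rightarrow> bool"
  where "csubspace M \<longleftrightarrow> 0 \<in> M \<and> (\<forall>x\<in>M. \<forall>y\<in>M. x + y \<in> M) \<and> (\<forall>c. \<forall>x\<in>M. c *\<^sub>C x \<in> M)"

lemma csubspace_closure:
  assumes "csubspace (M :: 'a::complex_inner set)"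
  shows "csubspace (closure M)"
  unfolding csubspace_def
proof (intro conjI ballI allI)
  show "0 \<in> closure M"
    using assms closure_subset by (auto simp: csubspace_def)
next
  fix x y assume "x \<in> closure M" "y \<in> closure M"
  then obtain f g where "\<And>n. f n \<in> M" "f \<longlonglongrightarrow> x" "\<And>n. g n \<in> M" "g \<longlonglongrightarrow> y"
    by (auto simp: closure_sequential)
  then show "x + y \<in> closure M"
    unfolding closure_sequential using assms
    by (intro exI[of _ "\<lambda>n. f n + g n"]) (auto simp: csubspace_def intro!: tendsto_add)
next
  fix c x assume "x \<in> closure M"
  then obtain f where "\<And>n. f n \<in> M" "f \<longlonglongrightarrow> x"
    by (auto simp: closure_sequential)
  then show "c *\<^sub>C x \<in> closure M"
    unfolding closure_sequential using assms
    by (intro exI[of _ "\<lambda>n. c *\<^sub>C f n"])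
      (auto simp: csubspace_def intro!: bounded_linear.tendsto[OF bounded_linear_scaleC])
qed

text \<open>The first-order condition at a minimum, with an explicit \<open>t\<close> in place of a derivative:
  \<open>t = - b / c\<close> would minimise the right-hand side, and \<open>c + 1\<close> guards against \<open>c = 0\<close>.\<close>

lemma quadratic_nonneg_imp_linear_term_zero:
  fixes b c :: real
  assumes "0 \<le> c" and nonneg: "\<And>t. 0 \<le> 2 * t * b + t\<^sup>2 * c"
  shows "b = 0"
proof (rule ccontr)
  assume "b \<noteq> 0"
  have "2 * (- b / (c + 1)) * b + (- b / (c + 1))\<^sup>2 * c = - (b\<^sup>2 * (c + 2)) / (c + 1)\<^sup>2"
    using \<open>0 \<le> c\<close> by (simp add: divide_simps power2_eq_square) (simp add: algebra_simps)
  also have "\<dots> < 0"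
    using \<open>0 \<le> c\<close> \<open>b \<noteq> 0\<close> by (intro divide_neg_pos) (auto intro!: mult_pos_pos)
  finally show False
    using nonneg[of "- b / (c + 1)"] by simp
qed

text \<open>The representing vector is the point of \<open>M\<close> that minimises
  \<open>F x = \<parallel>x\<parallel>\<^sup>2 - 2 Re (f x)\<close>. Uniform convexity of \<open>F\<close> makes a minimising sequence Cauchy, so
  completeness supplies the minimiser, and the first-order condition there is the claim for the real
  parts. Replacing \<open>x\<close> by \<open>\<i> x\<close> gives the imaginary parts.\<close>

lemma Riesz_representation_on_closed_subspace:
  fixes M :: "'a::chilbert_space set" and f :: "'a \<Rightarrow> complex"
  assumes "closed M" "csubspace M" "bounded_linear f" and f_scaleC: "\<And>c x. f (c *\<^sub>C x) = c * f x"
  obtains z where "z \<in> M" "\<And>x. x \<in> M \<Longrightarrow> f x = cinner x z"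
proof -
  interpret f: bounded_linear f by fact
  have M: "0 \<in> M" "\<And>x y. x \<in> M \<Longrightarrow> y \<in> M \<Longrightarrow> x + y \<in> M" "\<And>c x. x \<in> M \<Longrightarrow> c *\<^sub>C x \<in> M"
    using \<open>csubspace M\<close> by (auto simp: csubspace_def)
  obtain K where K: "\<And>x. cmod (f x) \<le> norm x * K"
    using f.bounded by blast
  define F where "F x = (norm x)\<^sup>2 - 2 * Re (f x)" for x
  have F_lower: "- (K\<^sup>2) \<le> F x" for x
  proof -
    have "Re (f x) \<le> norm x * K"
      using K[of x] complex_Re_le_cmod[of "f x"] by linarith
    moreover have "0 \<le> (norm x - K)\<^sup>2"
      by simp
    ultimately show ?thesis
      unfolding F_def power2_diff by linarith
  qed
  define d where "d = Inf (F ` M)"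
  have bdd: "bdd_below (F ` M)"
    using F_lower by (intro bdd_belowI) auto
  have d_le: "d \<le> F x" if "x \<in> M" for x
    unfolding d_def using that bdd by (intro cInf_lower) auto
  have near_d: "\<exists>x\<in>M. F x < d + e" if "0 < e" for e
    using cInf_lessD[of "F ` M" "d + e"] that M(1) by (auto simp: d_def)
  \<comment> \<open>the parallelogram law, in the form that makes \<open>F\<close> uniformly convex\<close>
  have F_gap: "(norm (x - y))\<^sup>2 \<le> 2 * (F x + F y - 2 * d)" if "x \<in> M" "y \<in> M" for x y
  proof -
    have mid: "(1 / 2) *\<^sub>C (x + y) \<in> M"
      using that M by blast
    have "(norm (x - y))\<^sup>2 = (norm x)\<^sup>2 - 2 * Re (cinner x y) + (norm y)\<^sup>2"
      using norm_add_square[of x "- y"] by (simp add: cinner_minus_right)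
    then have "(norm (x - y))\<^sup>2 = 2 * (F x + F y - 2 * F ((1 / 2) *\<^sub>C (x + y)))"
      by (simp add: F_def norm_add_square norm_scaleC f_scaleC f.add power_mult_distrib
          power_divide cinner_scaleC_left cinner_scaleC_right algebra_simps)
    then show ?thesis
      using d_le[OF mid] by simp
  qed
  have "\<exists>u. \<forall>n. u n \<in> M \<and> F (u n) < d + inverse (real (Suc n))"
    using near_d by (intro choice) (auto simp: Bex_def)
  then obtain u where u: "\<And>n. u n \<in> M" "\<And>n. F (u n) < d + inverse (real (Suc n))"
    by blast
  have "Cauchy u"
  proof (rule metric_CauchyI)
    fix e :: real assume "0 < e"
    then obtain n0 where n0: "inverse (real (Suc n0)) < e\<^sup>2 / 4"
      using reals_Archimedean[of "e\<^sup>2 / 4"] by auto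
    have small: "F (u n) < d + e\<^sup>2 / 4" if "n0 \<le> n" for n
    proof -
      have "inverse (real (Suc n)) \<le> inverse (real (Suc n0))"
        using that by (intro le_imp_inverse_le) auto
      then show ?thesis
        using u(2)[of n] n0 by linarith
    qed
    have "dist (u m) (u n) < e" if "n0 \<le> m" "n0 \<le> n" for m n
    proof -
      have "(norm (u m - u n))\<^sup>2 < e\<^sup>2"
        using F_gap[OF u(1)[of m] u(1)[of n]] add_strict_mono[OF small[OF that(1)] small[OF that(2)]]
        by (simp add: field_simps)
      then show ?thesis
        using \<open>0 < e\<close> by (simp add: dist_norm power_less_imp_less_base)
    qed
    then show "\<exists>n0. \<forall>m\<ge>n0. \<forall>n\<ge>n0. dist (u m) (u n) < e"
      by blast
  qed
  then obtain z where z: "u \<longlonglongrightarrow> z"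
    using Cauchy_convergent convergent_def by blast
  have "z \<in> M"
    using \<open>closed M\<close> u(1) z closed_sequentially by blast
  have "(\<lambda>n. F (u n)) \<longlonglongrightarrow> F z"
    unfolding F_def by (intro tendsto_intros z f.tendsto)
  moreover have "(\<lambda>n. d + inverse (real (Suc n))) \<longlonglongrightarrow> d + 0"
    by (intro tendsto_intros LIMSEQ_inverse_real_of_nat)
  ultimately have "F z \<le> d + 0"
    by (rule LIMSEQ_le) (use u(2) less_imp_le in blast)
  then have minimal: "F z \<le> F x" if "x \<in> M" for x
    using d_le[OF that] by simp
  have Re_eq: "Re (f x) = Re (cinner x z)" if "x \<in> M" for x
  proof -
    have "0 \<le> 2 * t * (Re (cinner z x) - Re (f x)) + t\<^sup>2 * (norm x)\<^sup>2" for t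
    proof -
      have "F z \<le> F (z + complex_of_real t *\<^sub>C x)"
        using M \<open>z \<in> M\<close> that by (intro minimal) auto
      then show ?thesis
        by (simp add: F_def norm_add_square norm_scaleC f_scaleC f.add cinner_scaleC_right
            power_mult_distrib algebra_simps)
    qed
    then have "Re (cinner z x) - Re (f x) = 0"
      by (intro quadratic_nonneg_imp_linear_term_zero[of "(norm x)\<^sup>2"]) auto
    then show ?thesis
      using cinner_commute[of z x] by simp
  qed
  have "f x = cinner x z" if "x \<in> M" for x
    using Re_eq[OF that] Re_eq[of "\<i> *\<^sub>C x"] M(3)[OF that]
    by (simp add: complex_eq_iff f_scaleC cinner_scaleC_left)
  then show ?thesis
    using that \<open>z \<in> M\<close> by blast
qed

text \<open>The projection of \<open>y\<close> represents the functional \<open>x \<mapsto> \<langle>x, y\<rangle>\<close> on \<open>M\<close>.\<close>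

lemma orthogonal_projection_exists:
  fixes M :: "'a::chilbert_space set"
  assumes "closed M" "csubspace M"
  obtains z where "z \<in> M" "\<And>x. x \<in> M \<Longrightarrow> cinner x (y - z) = 0"
  using Riesz_representation_on_closed_subspace[OF assms bounded_linear_cinner_left[of y]]
  by (metis cinner_diff_right cinner_scaleC_left right_minus_eq)

section \<open>Bounded operators and their adjoints\<close>

lemma bounded_clinearD:
  assumes "bounded_clinear T"
  shows "bounded_linear T" "T (c *\<^sub>C x) = c *\<^sub>C T x" "T (x + y) = T x + T y"
    "T (x - y) = T x - T y" "T 0 = 0"
  using assms unfolding bounded_clinear_def
  by (auto simp: linear_simps)

lemma bounded_clinearI:
  assumes "\<And>x y. T (x + y) = T x + T y" "\<And>c x. T (c *\<^sub>C x) = c *\<^sub>C T x"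
    and "\<And>x. norm (T x) \<le> K * norm x"
  shows "bounded_clinear T"
  unfolding bounded_clinear_def using assms
  by (auto intro!: bounded_linear_intro[where K = K] simp: scaleR_scaleC mult.commute)

lemma bounded_clinear_scaleC:
  assumes "bounded_clinear T"
  shows "bounded_clinear (\<lambda>x. c *\<^sub>C T x)"
  unfolding bounded_clinear_def
  using bounded_linear_compose[OF bounded_linear_scaleC bounded_clinearD(1)[OF assms]]
  by (auto simp: bounded_clinearD(2)[OF assms] scaleC_scaleC mult.commute)

lemma bounded_clinear_add:
  assumes "bounded_clinear S" "bounded_clinear T"
  shows "bounded_clinear (\<lambda>x. S x + T x)"
  unfolding bounded_clinear_def
  using bounded_linear_add[OF bounded_clinearD(1)[OF assms(1)] bounded_clinearD(1)[OF assms(2)]]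
  by (auto simp: bounded_clinearD(2)[OF assms(1)] bounded_clinearD(2)[OF assms(2)]
      complex_vector.scale_right_distrib)

lemma cadjoint_eqI:
  assumes "\<And>x y. cinner (T x) y = cinner x (S y)"
  shows "cadjoint T = S"
  unfolding cadjoint_def
proof (rule the_equality)
  fix R assume "\<forall>x y. cinner (T x) y = cinner x (R y)"
  then have "cinner x (R y) = cinner x (S y)" for x y
    using assms by simp
  then show "R = S"
    by (intro ext, rule cinner_ext)
qed (use assms in blast)

text \<open>The Riesz theorem on the whole space represents each functional \<open>x \<mapsto> \<langle>T x, y\<rangle>\<close>. This shows
  that the description defining \<open>cadjoint\<close> denotes.\<close>

lemma cinner_cadjoint:
  fixes T :: "'a::chilbert_space \<Rightarrow> 'a"
  assumes "bounded_clinear T"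
  shows "cinner (T x) y = cinner x (cadjoint T y)"
proof -
  note T = bounded_clinearD[OF assms]
  have "\<exists>z. \<forall>x. cinner (T x) y = cinner x z" for y
  proof -
    have "bounded_linear (\<lambda>x. cinner (T x) y)"
      by (rule bounded_linear_compose[OF bounded_linear_cinner_left T(1)])
    then show ?thesis
      by (rule Riesz_representation_on_closed_subspace[where M = UNIV, rotated 2])
        (auto simp: csubspace_def T(2) cinner_scaleC_left)
  qed
  then obtain S where "\<And>x y. cinner (T x) y = cinner x (S y)"
    by metis
  then show ?thesis
    using cadjoint_eqI[of T S] by simp
qed

lemma cadjoint_scaleC:
  fixes T :: "'a::chilbert_space \<Rightarrow> 'a"
  assumes "bounded_clinear T"
  shows "cadjoint (\<lambda>x. c *\<^sub>C T x) = (\<lambda>x. cnj c *\<^sub>C cadjoint T x)"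
  by (rule cadjoint_eqI)
    (simp add: cinner_scaleC_left cinner_scaleC_right cinner_cadjoint[OF assms])

text \<open>Polarisation: all values \<open>\<langle>A u, u\<rangle>\<close> are real, so expanding at \<open>u = x + y\<close> shows that
  \<open>\<langle>A x, y\<rangle> + \<langle>A y, x\<rangle>\<close> is real.\<close>

lemma positive_op_self_adjoint:
  assumes "positive_op A"
  shows "cinner (A x) y = cinner x (A y)"
proof -
  have A: "bounded_clinear A" and real: "\<And>u. Im (cinner (A u) u) = 0"
    using assms by (auto simp: positive_op_def complex_nonneg_Reals_iff)
  note A = bounded_clinearD[OF A]
  have "Im (cinner (A x) y) + Im (cinner (A y) x) = 0" for x
    using real[of "x + y"] real[of x] real[of y]
    by (simp add: A cinner_add_left cinner_add_right)
  \<comment> \<open>once for \<open>x\<close> itself and once for \<open>\<i> x\<close>, which turns real parts into imaginary parts\<close>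
  from this[of x] this[of "\<i> *\<^sub>C x"] have "cinner (A x) y = cnj (cinner (A y) x)"
    by (simp add: A cinner_scaleC_left cinner_scaleC_right complex_eq_iff)
  then show ?thesis
    by (simp add: cinner_commute[of x "A y"])
qed

text \<open>The closed sets on which all \<open>f i\<close> are bounded by \<open>n\<close> cover the space. By Baire's theorem one of
  them contains a ball \<open>cball a r\<close>, and by linearity every \<open>f i\<close> is bounded by \<open>2 n\<close> on the ball of
  radius \<open>r\<close> about the origin.\<close>

lemma uniform_boundedness:
  fixes f :: "'i \<Rightarrow> 'a::{real_normed_vector, complete_space} \<Rightarrow> 'b::real_normed_vector"
  assumes linear: "\<And>i. bounded_linear (f i)" and pointwise: "\<And>i x. norm (f i x) \<le> B x"
  obtains K where "0 \<le> K" "\<And>i x. norm (f i x) \<le> K * norm x"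
proof -
  define E where "E n = {x. \<forall>i. norm (f i x) \<le> real n}" for n
  have E_closed: "closed (E n)" for n
    unfolding E_def
    by (intro closed_Collect_all closed_Collect_le continuous_intros linear_continuous_on linear)
  have E_cover: "(\<Union>n. E n) = UNIV"
  proof (intro equalityI subsetI)
    fix x
    obtain n where "B x \<le> real n"
      using real_arch_simple by blast
    then have "x \<in> E n"
      unfolding E_def using pointwise[of _ x] order_trans by blast
    then show "x \<in> (\<Union>n. E n)"
      by blast
  qed simp
  have "\<exists>n. interior (E n) \<noteq> {}"
  proof (rule ccontr)
    assume "\<not> ?thesis"
    moreover have "Met_TC.mcomplete TYPE('a)"
      by (auto simp: Met_TC.mcomplete_def Cauchy_convergent_iff convergent_def)
    ultimately have "interior (\<Union>(range E)) = {}"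
      using Met_TC.metric_Baire_category_alt[of "range E"] E_closed by auto
    then show False
      using E_cover by simp
  qed
  then obtain n a r where r: "0 < r" "cball a r \<subseteq> E n"
    by (metis all_not_in_conv mem_interior_cball)
  have "norm (f i x) \<le> (2 * real n / r) * norm x" for i x
  proof (cases "x = 0")
    case True
    then show ?thesis
      using linear_simps(3)[OF linear] by simp
  next
    case False
    interpret f: bounded_linear "f i" by (rule linear)
    \<comment> \<open>\<open>x\<close> rescaled to the radius of the ball, so that \<open>a\<close> and \<open>a + y\<close> both lie in it\<close>
    define y where "y = (r / norm x) *\<^sub>R x"
    have "a \<in> E n" "a + y \<in> E n"
      using r False by (auto simp: y_def dist_norm intro!: subsetD[OF r(2)])
    then have "norm (f i a) \<le> real n" "norm (f i (a + y)) \<le> real n"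
      by (auto simp: E_def)
    then have "norm (f i y) \<le> 2 * real n"
      using norm_triangle_ineq4[of "f i (a + y)" "f i a"] by (simp add: f.add)
    moreover have "norm (f i y) = r / norm x * norm (f i x)"
      using r False by (simp add: y_def f.scaleR)
    ultimately show ?thesis
      using r False by (simp add: field_simps)
  qed
  with that[of "2 * real n / r"] r show ?thesis
    by simp
qed

section \<open>The reduced adjoint with respect to a positive operator\<close>

text \<open>As \<open>A\<close> is self-adjoint, its kernel is orthogonal to its range.\<close>

lemma closure_range_inter_kernel:
  assumes A: "positive_op A" and "z \<in> closure (range A)" "A z = 0"
  shows "z = 0"
proof -
  have "norm z \<le> 0"
    by (rule norm_le_if_cinner_bound[OF _ assms(2)])
      (auto simp: positive_op_self_adjoint[OF A, symmetric] \<open>A z = 0\<close>)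
  then show ?thesis
    by simp
qed

lemma csubspace_range:
  assumes "bounded_clinear A"
  shows "csubspace (range A)"
  unfolding csubspace_def
  by (auto simp: bounded_clinearD(2,3)[OF assms, symmetric]
      intro: range_eqI[of _ A 0] bounded_clinearD(5)[OF assms, symmetric])

text \<open>A choice of preimages turns the inclusion of ranges into an equation, which is easier to
  combine for sums and multiples of operators.\<close>

lemma ops_A_iff:
  "T \<in> ops_A A \<longleftrightarrow> bounded_clinear T \<and> (\<exists>Y. \<forall>x. cadjoint T (A x) = A (Y x))"
  unfolding ops_A_def by (simp add: image_subset_iff image_iff choice_iff)

context
  fixes A :: "'a::chilbert_space \<Rightarrow> 'a"
  assumes A: "positive_op A"
begin

lemma bounded_clinear_A: "bounded_clinear A"
  using A by (simp add: positive_op_def)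

lemmas A_simps = bounded_clinearD(2-)[OF bounded_clinear_A]
lemmas A_self_adjoint = positive_op_self_adjoint[OF A]

lemma csubspace_closure_range: "csubspace (closure (range A))"
  by (intro csubspace_closure csubspace_range bounded_clinear_A)

lemma diff_in_closure_range:
  assumes "x \<in> closure (range A)" "y \<in> closure (range A)"
  shows "x - y \<in> closure (range A)"
proof -
  have "x + (- 1) *\<^sub>C y \<in> closure (range A)"
    using csubspace_closure_range assms unfolding csubspace_def by blast
  then show ?thesis
    by (simp add: complex_vector.scale_minus_left scaleC_one)
qed

lemma closure_range_eqI:
  assumes "x \<in> closure (range A)" "y \<in> closure (range A)" "A x = A y"
  shows "x = y"
proof -
  have "A (x - y) = 0"
    by (simp add: A_simps assms(3))
  then have "x - y = 0"
    by (rule closure_range_inter_kernel[OF A diff_in_closure_range[OF assms(1,2)]])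
  then show ?thesis
    by simp
qed

lemma sharp_eqI:
  assumes "bounded_clinear X" "\<And>x. A (X x) = cadjoint T (A x)" "\<And>x. X x \<in> closure (range A)"
  shows "sharp A T = X"
  unfolding sharp_def
proof (rule the_equality)
  fix Z assume "bounded_clinear Z \<and> A \<circ> Z = cadjoint T \<circ> A \<and> range Z \<subseteq> closure (range A)"
  then have "Z x \<in> closure (range A)" "A (Z x) = A (X x)" for x
    using assms(2) by (auto simp: fun_eq_iff)
  then show "Z = X"
    by (intro ext, rule closure_range_eqI[OF _ assms(3)])
qed (use assms in \<open>auto simp: fun_eq_iff\<close>)

text \<open>Douglas' factorisation argument, for the equation \<open>A X = T\<^sup>* A\<close>. The identity \<open>weak\<close> of the proof
  determines \<open>X x\<close> in the closure of the range of \<open>A\<close>; linearity of \<open>X\<close> is read off from it, and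
  so is boundedness, by uniform boundedness over all \<open>y\<close>.\<close>

lemma sharp_exists:
  assumes "T \<in> ops_A A"
  obtains X where "bounded_clinear X" "\<And>x. A (X x) = cadjoint T (A x)"
    "\<And>x. X x \<in> closure (range A)"
proof -
  obtain Y where T: "bounded_clinear T" and Y: "\<And>x. cadjoint T (A x) = A (Y x)"
    using assms by (auto simp: ops_A_iff)
  have "\<exists>z. z \<in> closure (range A) \<and> A z = A y" for y
  proof -
    obtain z where z: "z \<in> closure (range A)"
      "\<And>x. x \<in> closure (range A) \<Longrightarrow> cinner x (y - z) = 0"
      using orthogonal_projection_exists[OF closed_closure csubspace_closure_range] by blast
    have "cinner u (A z) = cinner u (A y)" for u
    proof -
      have "cinner (A u) (y - z) = 0"
        by (rule z(2)) (rule subsetD[OF closure_subset rangeI])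
      then show ?thesis
        by (simp add: A_self_adjoint A_simps cinner_diff_right)
    qed
    then show ?thesis
      using z(1) cinner_ext by blast
  qed
  then obtain P where P: "\<And>y. P y \<in> closure (range A)" "\<And>y. A (P y) = A y"
    by metis
  define X where "X x = P (Y x)" for x
  have X_closure: "X x \<in> closure (range A)" and AX: "A (X x) = cadjoint T (A x)" for x
    by (simp_all add: X_def P Y)
  have weak: "cinner (X x) (A y) = cinner x (A (T y))" for x y
  proof -
    have "cinner (X x) (A y) = cnj (cinner y (cadjoint T (A x)))"
      by (metis A_self_adjoint AX cinner_commute)
    also have "\<dots> = cinner (A x) (T y)"
      by (metis cinner_cadjoint[OF T] cinner_commute)
    finally show ?thesis
      by (simp add: A_self_adjoint)
  qed
  have weak_eqI: "x = y" if "x \<in> closure (range A)" "y \<in> closure (range A)"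
    "\<And>u. cinner x (A u) = cinner y (A u)" for x y
  proof (rule closure_range_eqI[OF that(1,2)])
    have "cinner u (A x) = cinner u (A y)" for u
      using that(3)[of u] by (metis A_self_adjoint cinner_commute)
    then show "A x = A y"
      by (rule cinner_ext)
  qed
  have add: "X (x + y) = X x + X y" for x y
    by (rule weak_eqI)
      (use X_closure csubspace_closure_range in \<open>auto simp: csubspace_def weak cinner_add_left\<close>)
  have scaleC: "X (c *\<^sub>C x) = c *\<^sub>C X x" for c x
    by (rule weak_eqI)
      (use X_closure csubspace_closure_range in \<open>auto simp: csubspace_def weak cinner_scaleC_left\<close>)
  \<comment> \<open>where \<open>A y = 0\<close>, division by zero makes the functional vanish, as it should\<close>
  define f where "f y x = cinner x (A (T y)) / complex_of_real (norm (A y))" for y x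
  have "bounded_linear (f y)" for y
    unfolding f_def
    by (rule bounded_linear_compose[OF bounded_linear_divide bounded_linear_cinner_left])
  moreover have "cmod (f y x) \<le> norm (X x)" for y x
    using cinner_Cauchy_Schwarz[of "X x" "A y"]
    by (cases "A y = 0") (auto simp: f_def weak norm_divide field_simps)
  ultimately obtain K where K: "0 \<le> K" "\<And>y x. cmod (f y x) \<le> K * norm x"
    using uniform_boundedness[of f "\<lambda>x. norm (X x)"] by blast
  have "norm (X x) \<le> K * norm x" for x
  proof (rule norm_le_if_cinner_bound[OF _ X_closure])
    fix v assume "v \<in> range A"
    then obtain y where y: "v = A y" by blast
    show "cmod (cinner (X x) v) \<le> K * norm x * norm v"
      using K(2)[of y x] weak[of x y]
      by (cases "A y = 0") (auto simp: y f_def norm_divide field_simps)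
  qed (use K(1) in simp)
  with add scaleC have "bounded_clinear X"
    by (rule bounded_clinearI)
  with that AX X_closure show ?thesis
    by blast
qed

lemma sharp_properties:
  assumes "T \<in> ops_A A"
  shows "bounded_clinear (sharp A T)" "A (sharp A T x) = cadjoint T (A x)"
    "sharp A T x \<in> closure (range A)"
  using sharp_exists[OF assms] sharp_eqI by metis+

text \<open>Taking adjoints in \<open>A X = T\<^sup>* A\<close> for \<open>X = sharp A T\<close> gives \<open>X\<^sup>* A = A T\<close>, whose range lies in that
  of \<open>A\<close>.\<close>

lemma sharp_in_ops_A:
  assumes "T \<in> ops_A A"
  shows "sharp A T \<in> ops_A A"
proof -
  have T: "bounded_clinear T"
    using assms by (simp add: ops_A_iff)
  note S = sharp_properties[OF assms]
  have "cinner u (cadjoint (sharp A T) (A x)) = cinner u (A (T x))" for u x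
  proof -
    have "cinner u (cadjoint (sharp A T) (A x)) = cinner (cadjoint T (A u)) x"
      by (simp add: cinner_cadjoint[OF S(1), symmetric] A_self_adjoint[symmetric] S(2))
    also have "\<dots> = cinner (A u) (T x)"
      by (metis cinner_cadjoint[OF T] cinner_commute)
    finally show ?thesis
      by (simp add: A_self_adjoint)
  qed
  then have "cadjoint (sharp A T) (A x) = A (T x)" for x
    by (rule cinner_ext)
  with S(1) show ?thesis
    by (auto simp: ops_A_iff)
qed

lemma ops_A_scaleC:
  assumes "T \<in> ops_A A"
  shows "(\<lambda>x. c *\<^sub>C T x) \<in> ops_A A"
proof -
  obtain Y where T: "bounded_clinear T" and Y: "\<And>x. cadjoint T (A x) = A (Y x)"
    using assms by (auto simp: ops_A_iff)
  show ?thesis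
    unfolding ops_A_iff cadjoint_scaleC[OF T] Y
    by (auto simp: A_simps(1)[symmetric] bounded_clinear_scaleC[OF T])
qed

lemma ops_A_add:
  assumes "S \<in> ops_A A" "T \<in> ops_A A"
  shows "(\<lambda>x. S x + T x) \<in> ops_A A"
proof -
  obtain Y Z where S: "bounded_clinear S" and Y: "\<And>x. cadjoint S (A x) = A (Y x)"
    and T: "bounded_clinear T" and Z: "\<And>x. cadjoint T (A x) = A (Z x)"
    using assms by (auto simp: ops_A_iff)
  have "cadjoint (\<lambda>x. S x + T x) = (\<lambda>x. cadjoint S x + cadjoint T x)"
    by (rule cadjoint_eqI)
      (simp add: cinner_add_left cinner_add_right cinner_cadjoint[OF S] cinner_cadjoint[OF T])
  then show ?thesis
    unfolding ops_A_iff
    by (auto simp: Y Z A_simps(2)[symmetric] bounded_clinear_add[OF S T])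
qed

lemma sharp_scaleC:
  assumes "T \<in> ops_A A"
  shows "sharp A (\<lambda>x. c *\<^sub>C T x) = (\<lambda>x. cnj c *\<^sub>C sharp A T x)"
proof (rule sharp_eqI)
  have T: "bounded_clinear T"
    using assms by (simp add: ops_A_iff)
  note S = sharp_properties[OF assms]
  show "bounded_clinear (\<lambda>x. cnj c *\<^sub>C sharp A T x)"
    by (rule bounded_clinear_scaleC[OF S(1)])
  show "A (cnj c *\<^sub>C sharp A T x) = cadjoint (\<lambda>x. c *\<^sub>C T x) (A x)" for x
    by (simp add: cadjoint_scaleC[OF T] A_simps S(2))
  show "cnj c *\<^sub>C sharp A T x \<in> closure (range A)" for x
    using csubspace_closure_range S(3) by (auto simp: csubspace_def)
qed

end

section \<open>The Cartesian decomposition and the numerical radius\<close>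

lemma seminorm_onD:
  assumes "seminorm_on V N" "S \<in> V"
  shows "0 \<le> N S" "N (\<lambda>x. c *\<^sub>C S x) = cmod c * N S"
    "T \<in> V \<Longrightarrow> N (\<lambda>x. S x + T x) \<le> N S + N T"
  using assms by (auto simp: seminorm_on_def)

lemma Cartesian_decomposition: "T x = Re_A A T x + \<i> *\<^sub>C Im_A A T x"
proof -
  have "Re_A A T x + \<i> *\<^sub>C Im_A A T x = (1 / 2 + 1 / 2) *\<^sub>C T x"
    unfolding Re_A_def Im_A_def complex_vector.scale_left_distrib
      complex_vector.scale_right_distrib complex_vector.scale_right_diff_distrib
    by (simp add: algebra_simps)
  then show ?thesis
    by (simp add: scaleC_one)
qed

context
  fixes A :: "'a::chilbert_space \<Rightarrow> 'a"
  assumes A: "positive_op A"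
begin

lemma Re_A_in_ops_A: "T \<in> ops_A A \<Longrightarrow> Re_A A T \<in> ops_A A"
  unfolding Re_A_def by (intro ops_A_scaleC[OF A] ops_A_add[OF A] sharp_in_ops_A[OF A])

lemma Im_A_in_ops_A:
  assumes "T \<in> ops_A A"
  shows "Im_A A T \<in> ops_A A"
proof -
  have "Im_A A T = (\<lambda>x. (1 / (2 * \<i>)) *\<^sub>C (T x + (- 1) *\<^sub>C sharp A T x))"
    by (simp add: Im_A_def complex_vector.scale_minus_left scaleC_one)
  then show ?thesis
    using assms by (simp only:) (intro ops_A_scaleC[OF A] ops_A_add[OF A] sharp_in_ops_A[OF A])
qed

text \<open>With \<open>c = a + \<i> b\<close> the left-hand side is \<open>(c T + cnj c T\<^sup>#) / 2\<close>, where \<open>T\<^sup># = sharp A T\<close>; collecting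
  the terms with \<open>a\<close> and with \<open>b\<close> gives the two parts of \<open>T\<close>.\<close>

lemma Re_A_scaleC:
  assumes "T \<in> ops_A A"
  shows "Re_A A (\<lambda>x. c *\<^sub>C T x) =
    (\<lambda>x. complex_of_real (Re c) *\<^sub>C Re_A A T x + complex_of_real (- Im c) *\<^sub>C Im_A A T x)"
proof
  fix x
  define a b where "a = complex_of_real (Re c)" and "b = complex_of_real (Im c)"
  have "c = a + \<i> * b" and "cnj c = a - \<i> * b"
    by (simp_all add: a_def b_def complex_eq_iff)
  moreover have "- b / (2 * \<i>) = \<i> * b / 2"
    by (simp add: field_simps)
  ultimately have c: "c / 2 = a / 2 + - b / (2 * \<i>)" "cnj c / 2 = a / 2 - - b / (2 * \<i>)"
    by (simp_all only: add_divide_distrib diff_divide_distrib)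
  have "Re_A A (\<lambda>x. c *\<^sub>C T x) x = (c / 2) *\<^sub>C T x + (cnj c / 2) *\<^sub>C sharp A T x"
    by (simp add: Re_A_def sharp_scaleC[OF A assms] complex_vector.scale_right_distrib)
  also have "\<dots> = (a / 2 + - b / (2 * \<i>)) *\<^sub>C T x + (a / 2 - - b / (2 * \<i>)) *\<^sub>C sharp A T x"
    by (simp only: c)
  also have "\<dots> = a *\<^sub>C Re_A A T x + (- b) *\<^sub>C Im_A A T x"
    unfolding Re_A_def Im_A_def complex_vector.scale_left_distrib
      complex_vector.scale_left_diff_distrib complex_vector.scale_right_distrib
      complex_vector.scale_right_diff_distrib
    by (simp add: algebra_simps)
  finally show "Re_A A (\<lambda>x. c *\<^sub>C T x) x =
      complex_of_real (Re c) *\<^sub>C Re_A A T x + complex_of_real (- Im c) *\<^sub>C Im_A A T x"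
    by (simp add: a_def b_def)
qed

text \<open>A supremum of reals dominates its family only if the family is bounded above; here
  \<open>Re_A_scaleC\<close> and \<open>\<bar>Re c\<bar>, \<bar>Im c\<bar> \<le> 1\<close> give the bound \<open>N (Re_A A T) + N (Im_A A T)\<close>.\<close>

lemma le_num_radius_A:
  assumes N: "seminorm_on (ops_A A) N" and T: "T \<in> ops_A A"
  shows "N (Re_A A (\<lambda>x. exp (\<i> * complex_of_real \<theta>) *\<^sub>C T x)) \<le> num_radius_A A N T"
proof -
  note mem = Re_A_in_ops_A[OF T] Im_A_in_ops_A[OF T]
  have "N (Re_A A (\<lambda>x. c *\<^sub>C T x)) \<le> N (Re_A A T) + N (Im_A A T)" if "cmod c = 1" for c
  proof -
    have "N (Re_A A (\<lambda>x. c *\<^sub>C T x)) \<le> \<bar>Re c\<bar> * N (Re_A A T) + \<bar>Im c\<bar> * N (Im_A A T)"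
      using seminorm_onD(3)[OF N ops_A_scaleC[OF A mem(1), of "complex_of_real (Re c)"]
          ops_A_scaleC[OF A mem(2), of "complex_of_real (- Im c)"]]
      by (simp add: Re_A_scaleC[OF T] seminorm_onD(2)[OF N] mem del: of_real_minus)
    also have "\<dots> \<le> 1 * N (Re_A A T) + 1 * N (Im_A A T)"
      using that abs_Re_le_cmod[of c] abs_Im_le_cmod[of c]
      by (intro add_mono mult_right_mono seminorm_onD(1)[OF N] mem) auto
    finally show ?thesis
      by simp
  qed
  then show ?thesis
    unfolding num_radius_A_def
    by (intro cSUP_upper2[where x = \<theta>] bdd_aboveI2[where M = "N (Re_A A T) + N (Im_A A T)"]) auto
qed

end

theorem theorem2p2:
  fixes A T :: "'a::chilbert_space \<Rightarrow> 'a"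
    and N :: "('a \<Rightarrow> 'a) \<Rightarrow> real"
  assumes "positive_op A"
    and "A \<noteq> (\<lambda>x. 0)"
    and "seminorm_on (ops_A A) N"
    and "T \<in> ops_A A"
  shows "num_radius_A A N T \<ge> N T / 2 + \<bar>N (Re_A A T) - N (Im_A A T)\<bar> / 2"
proof -
  note A = assms(1) and N = assms(3) and T = assms(4)
  note mem = Re_A_in_ops_A[OF A T] Im_A_in_ops_A[OF A T]
  have "N (Re_A A T) \<le> num_radius_A A N T"
    using le_num_radius_A[OF A N T, of 0] by (simp add: scaleC_one)
  moreover have "N (Im_A A T) \<le> num_radius_A A N T"
  proof -
    have "exp (\<i> * complex_of_real (pi / 2)) = \<i>"
      by (simp add: cis_conv_exp[symmetric] del: of_real_divide)
    moreover have "N (Re_A A (\<lambda>x. \<i> *\<^sub>C T x)) = N (Im_A A T)"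
      using seminorm_onD(2)[OF N mem(2), of "- 1"] by (simp add: Re_A_scaleC[OF A T])
    ultimately show ?thesis
      using le_num_radius_A[OF A N T, of "pi / 2"] by simp
  qed
  moreover have "N T \<le> N (Re_A A T) + N (Im_A A T)"
  proof -
    have "N T = N (\<lambda>x. Re_A A T x + \<i> *\<^sub>C Im_A A T x)"
      by (simp add: Cartesian_decomposition[symmetric])
    also have "\<dots> \<le> N (Re_A A T) + N (\<lambda>x. \<i> *\<^sub>C Im_A A T x)"
      by (rule seminorm_onD(3)[OF N mem(1) ops_A_scaleC[OF A mem(2)]])
    finally show ?thesis
      by (simp add: seminorm_onD(2)[OF N mem(2)])
  qed
  ultimately show ?thesis
    by (simp add: abs_if field_simps)
qed

end
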